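(* Let $A$ be a Ritt algebra, and let $B$ be a differentially finitely generated differential algebra over $A$ that is an integral domain. Then there exists a nonzero element $s\in B$ for which $B_s=C[y_\alpha]$, where $C$ is a finitely generated algebra over $A$ (an $A$-subalgebra of $B_s$) and $\{y_\alpha\}$ is an at most countable set of elements of $B_s$ algebraically independent over $C$.
   Context: Rings are commutative with identity. A differential ring is a ring with a finite set $\Delta$ of pairwise commuting derivations. A Ritt algebra is a differential ring which is an algebra over $\mathbb Q$. A differential algebra $B$ over a differential ring $A$ (with structure map a differential homomorphism $A\to B$) is differentially finitely generated if it is generated as an $A$-algebra by finitely many elements together with all their derivatives of all orders. $B_s$ denotes the localization of $B$ at the powers of $s$. "Finitely generated algebra over $A$" is meant in the ordinary (non-differential) sense; $C$ is not required to be stable under the derivations. The equality $B_s=C[y_\alpha]$ means that $B_s$ is the polynomial ring over $C$ in the variables $y_\alpha$ (the set of variables may be finite or empty). *)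

theory Defs
  imports
    "HOL-Library.Poly_Mapping"
    "HOL-Library.Countable_Set"
    "HOL-Computational_Algebra.Fraction_Field"
    Complex_Main
begin

definition is_ring_hom :: "('a::comm_ring_1 \<Rightarrow> 'b::comm_ring_1) \<Rightarrow> bool" where
  "is_ring_hom f \<longleftrightarrow>
     f 1 = 1 \<and> (\<forall>x y. f (x + y) = f x + f y) \<and> (\<forall>x y. f (x * y) = f x * f y)"

definition is_subring :: "'a::comm_ring_1 set \<Rightarrow> bool" where
  "is_subring S \<longleftrightarrow>
     0 \<in> S \<and> 1 \<in> S \<and> (\<forall>x\<in>S. - x \<in> S) \<and> (\<forall>x\<in>S. \<forall>y\<in>S. x + y \<in> S \<and> x * y \<in> S)"

text \<open>For a structure map \<open>f\<close> from \<open>A\<close> to \<open>B\<close>: the \<open>A\<close>-subalgebra of \<open>B\<close> generated by \<open>S\<close>.\<close>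

definition generated_algebra ::
    "('a::comm_ring_1 \<Rightarrow> 'b::comm_ring_1) \<Rightarrow> 'b set \<Rightarrow> 'b set" where
  "generated_algebra f S = is_subring hull (range f \<union> S)"

definition is_derivation :: "('a::comm_ring_1 \<Rightarrow> 'a) \<Rightarrow> bool" where
  "is_derivation d \<longleftrightarrow>
     (\<forall>x y. d (x + y) = d x + d y) \<and> (\<forall>x y. d (x * y) = d x * y + x * d y)"

text \<open>The derivations are given as a finite family indexed by \<open>I\<close> (possibly empty), so that the
  same symbols can act both on \<open>A\<close> and on an \<open>A\<close>-algebra.\<close>

definition differential_ring :: "'i set \<Rightarrow> ('i \<Rightarrow> 'a::comm_ring_1 \<Rightarrow> 'a) \<Rightarrow> bool" where
  "differential_ring I \<delta> \<longleftrightarrow>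
     finite I \<and> (\<forall>i\<in>I. is_derivation (\<delta> i)) \<and>
     (\<forall>i\<in>I. \<forall>j\<in>I. \<forall>x. \<delta> i (\<delta> j x) = \<delta> j (\<delta> i x))"

definition ritt_algebra :: "'i set \<Rightarrow> ('i \<Rightarrow> 'a::comm_ring_1 \<Rightarrow> 'a) \<Rightarrow> bool" where
  "ritt_algebra I \<delta> \<longleftrightarrow>
     differential_ring I \<delta> \<and> (\<exists>h :: rat \<Rightarrow> 'a. is_ring_hom h)"

definition differential_hom ::
    "'i set \<Rightarrow> ('i \<Rightarrow> 'a::comm_ring_1 \<Rightarrow> 'a) \<Rightarrow> ('i \<Rightarrow> 'b::comm_ring_1 \<Rightarrow> 'b) \<Rightarrow> ('a \<Rightarrow> 'b) \<Rightarrow> bool"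
  where
  "differential_hom I \<delta>A \<delta>B f \<longleftrightarrow>
     is_ring_hom f \<and> (\<forall>i\<in>I. \<forall>x. f (\<delta>A i x) = \<delta>B i (f x))"

definition differential_algebra ::
    "'i set \<Rightarrow> ('i \<Rightarrow> 'a::comm_ring_1 \<Rightarrow> 'a) \<Rightarrow> ('i \<Rightarrow> 'b::comm_ring_1 \<Rightarrow> 'b) \<Rightarrow> ('a \<Rightarrow> 'b) \<Rightarrow> bool"
  where
  "differential_algebra I \<delta>A \<delta>B f \<longleftrightarrow>
     differential_ring I \<delta>A \<and> differential_ring I \<delta>B \<and> differential_hom I \<delta>A \<delta>B f"

inductive_set derivatives :: "'i set \<Rightarrow> ('i \<Rightarrow> 'b \<Rightarrow> 'b) \<Rightarrow> 'b set \<Rightarrow> 'b set"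
  for I :: "'i set" and \<delta> :: "'i \<Rightarrow> 'b \<Rightarrow> 'b" and G :: "'b set" where
  base: "x \<in> G \<Longrightarrow> x \<in> derivatives I \<delta> G"
| step: "x \<in> derivatives I \<delta> G \<Longrightarrow> i \<in> I \<Longrightarrow> \<delta> i x \<in> derivatives I \<delta> G"

definition differentially_finitely_generated ::
    "'i set \<Rightarrow> ('i \<Rightarrow> 'b::comm_ring_1 \<Rightarrow> 'b) \<Rightarrow> ('a::comm_ring_1 \<Rightarrow> 'b) \<Rightarrow> bool" where
  "differentially_finitely_generated I \<delta>B f \<longleftrightarrow>
     (\<exists>G. finite G \<and> generated_algebra f (derivatives I \<delta>B G) = UNIV)"

text \<open>For a domain \<open>B\<close> and \<open>s \<noteq> 0\<close>, the localization \<open>B\<^sub>s\<close> at the powers of \<open>s\<close> is taken as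
  the subring of all \<open>b / s^n\<close> in the fraction field of \<open>B\<close>.  The definition is only meaningful
  for \<open>s \<noteq> 0\<close>.\<close>

definition localization_away :: "'b::idom \<Rightarrow> 'b fract set" where
  "localization_away s = {Fract b (s ^ n) | b n. True}"

definition to_localization :: "('a \<Rightarrow> 'b::idom) \<Rightarrow> 'a \<Rightarrow> 'b fract" where
  "to_localization f a = Fract (f a) 1"

definition finitely_generated_subalgebra ::
    "('a::comm_ring_1 \<Rightarrow> 'b::comm_ring_1) \<Rightarrow> 'b set \<Rightarrow> bool" where
  "finitely_generated_subalgebra f C \<longleftrightarrow> (\<exists>F. finite F \<and> C = generated_algebra f F)"

text \<open>Multivariate polynomials with variables in \<open>'v\<close> and coefficients in \<open>'c\<close> are the finitely
  supported maps from monomials \<open>'v \<Rightarrow>\<^sub>0 nat\<close> to coefficients.\<close>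

definition poly_eval :: "('v \<Rightarrow> 'c::comm_ring_1) \<Rightarrow> (('v \<Rightarrow>\<^sub>0 nat) \<Rightarrow>\<^sub>0 'c) \<Rightarrow> 'c" where
  "poly_eval y p =
     (\<Sum>m\<in>Poly_Mapping.keys p.
        Poly_Mapping.lookup p m * (\<Prod>v\<in>Poly_Mapping.keys m. y v ^ Poly_Mapping.lookup m v))"

text \<open>The elements of \<open>Y\<close> serve as the names of their own variables.\<close>

definition algebraically_independent :: "'c::comm_ring_1 set \<Rightarrow> 'c set \<Rightarrow> bool" where
  "algebraically_independent C Y \<longleftrightarrow>
     (\<forall>p :: ('c \<Rightarrow>\<^sub>0 nat) \<Rightarrow>\<^sub>0 'c.
        range (Poly_Mapping.lookup p) \<subseteq> C \<and>
        (\<forall>m\<in>Poly_Mapping.keys p. Poly_Mapping.keys m \<subseteq> Y) \<and>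
        poly_eval (\<lambda>v. v) p = 0 \<longrightarrow> p = 0)"

definition polynomial_ring_over :: "'c::comm_ring_1 set \<Rightarrow> 'c set \<Rightarrow> 'c set \<Rightarrow> bool" where
  "polynomial_ring_over R C Y \<longleftrightarrow>
     R = is_subring hull (C \<union> Y) \<and> algebraically_independent C Y"

end

theory Submission
  imports Defs "HOL-Library.Multiset_Order" "HOL-Library.Product_Lexorder"
    "HOL-Computational_Algebra.Polynomial_Factorial"
begin

text \<open>
  Rank the derivatives of the generators by an orderly ranking, so that each has only finitely many
  predecessors, and let \<open>R n\<close> be the subalgebra generated by those of rank below \<open>n\<close>.  Call a
  derivative \<open>u\<close> a leader if it is algebraic over its predecessors.  Differentiating a relation of
  minimal degree for \<open>u\<close>, whose separant does not vanish in characteristic zero, shows that every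
  proper derivative of \<open>u\<close> is a leader and becomes an element of the algebra of its predecessors
  once the separant is inverted.  By Dickson's lemma all leaders are derivatives of finitely many
  of them.  Take \<open>N\<close> above the ranks of these and \<open>s\<close> the product of their separants: over
  \<open>C = R N[1/s]\<close> the leaders of rank at least \<open>N\<close> are redundant generators of \<open>B\<^sub>s\<close>, and the
  non-leaders of rank at least \<open>N\<close> are algebraically independent, each being transcendental over
  its predecessors.
\<close>

section \<open>Subrings and generated algebras\<close>

lemma is_subring_hull: "is_subring (is_subring hull X)"
  by (rule hull_in) (auto simp: is_subring_def)

lemma is_subring_generated_algebra: "is_subring (generated_algebra f X)"
  unfolding generated_algebra_def by (rule is_subring_hull)

lemma subring_closed:
  assumes "is_subring S"
  shows "0 \<in> S" "1 \<in> S" "x \<in> S \<Longrightarrow> - x \<in> S"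
    "x \<in> S \<Longrightarrow> y \<in> S \<Longrightarrow> x + y \<in> S" "x \<in> S \<Longrightarrow> y \<in> S \<Longrightarrow> x * y \<in> S"
  using assms by (auto simp: is_subring_def)

lemma subring_minus:
  assumes "is_subring S" "x \<in> S" "y \<in> S"
  shows "x - y \<in> S"
  using subring_closed(3,4)[OF assms(1)] assms(2,3) by (metis uminus_add_conv_diff add.commute)

lemma subring_sum:
  assumes "is_subring S" "\<And>i. i \<in> A \<Longrightarrow> f i \<in> S"
  shows "sum f A \<in> S"
  using assms(2) by (induction A rule: infinite_finite_induct)
    (auto intro: subring_closed[OF assms(1)])

lemma subring_prod:
  assumes "is_subring S" "\<And>i. i \<in> A \<Longrightarrow> f i \<in> S"
  shows "prod f A \<in> S"
  using assms(2) by (induction A rule: infinite_finite_induct)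
    (auto intro: subring_closed[OF assms(1)])

lemma subring_power:
  assumes "is_subring S" "x \<in> S"
  shows "x ^ n \<in> S"
  by (induction n) (auto intro: subring_closed[OF assms(1)] assms(2))

lemma subring_of_nat:
  assumes "is_subring S"
  shows "of_nat n \<in> S"
  by (induction n) (auto intro: subring_closed[OF assms(1)])

lemma subring_poly:
  assumes "is_subring S" "\<And>n. coeff p n \<in> S" "x \<in> S"
  shows "poly p x \<in> S"
  unfolding poly_altdef by (intro subring_sum subring_closed(5) subring_power assms)

lemma generated_algebra_mono: "X \<subseteq> Y \<Longrightarrow> generated_algebra f X \<subseteq> generated_algebra f Y"
  unfolding generated_algebra_def by (intro hull_mono) auto

lemma generated_algebra_base: "f a \<in> generated_algebra f X"
  unfolding generated_algebra_def by (intro hull_inc) auto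

lemma generated_algebra_gen: "x \<in> X \<Longrightarrow> x \<in> generated_algebra f X"
  unfolding generated_algebra_def by (intro hull_inc) auto

lemma generated_algebra_minimal:
  assumes "is_subring S" "\<And>a. f a \<in> S" "X \<subseteq> S"
  shows "generated_algebra f X \<subseteq> S"
  unfolding generated_algebra_def using assms by (intro hull_minimal) auto

lemma is_subring_vimage:
  assumes "is_ring_hom h" "is_subring S"
  shows "is_subring (h -` S)"
proof -
  have "h (0 + 0) = h 0 + h 0" using assms(1) unfolding is_ring_hom_def by blast
  then have h0: "h 0 = 0" by simp
  have hneg: "h (- x) = - h x" for x
  proof -
    have "h (x + - x) = h x + h (- x)" using assms(1) unfolding is_ring_hom_def by blast
    then show ?thesis using h0 by (simp add: eq_neg_iff_add_eq_0 add.commute)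
  qed
  show ?thesis using assms h0 hneg by (auto simp: is_subring_def is_ring_hom_def)
qed

section \<open>Derivations\<close>

lemma derivation_0:
  assumes "is_derivation d"
  shows "d 0 = 0"
proof -
  have "d (0 + 0) = d 0 + d 0" using assms unfolding is_derivation_def by blast
  then show ?thesis by simp
qed

lemma derivation_1:
  assumes "is_derivation d"
  shows "d 1 = 0"
proof -
  have "d (1 * 1) = d 1 * 1 + 1 * d 1" using assms unfolding is_derivation_def by blast
  then show ?thesis by simp
qed

lemma derivation_uminus:
  assumes "is_derivation d"
  shows "d (- x) = - d x"
proof -
  have "d (x + - x) = d x + d (- x)" using assms unfolding is_derivation_def by blast
  then show ?thesis using derivation_0[OF assms] by (simp add: eq_neg_iff_add_eq_0 add.commute)
qed

text \<open>By the Leibniz rule, the elements of \<open>S\<close> that \<open>d\<close> maps into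
  \<open>S\<close> form a subring, so checking generators suffices. \<open>S\<close> may exceed the
  generated algebra, because differentiation raises the rank.\<close>

lemma derivation_into_subring:
  assumes d: "is_derivation d" and S: "is_subring S"
    and base: "\<And>a. f a \<in> S" "\<And>a. d (f a) \<in> S"
    and gen: "\<And>x. x \<in> X \<Longrightarrow> x \<in> S" "\<And>x. x \<in> X \<Longrightarrow> d x \<in> S"
    and z: "z \<in> generated_algebra f X"
  shows "d z \<in> S"
proof -
  have "is_subring {z \<in> S. d z \<in> S}"
    using d subring_closed[OF S] derivation_0[OF d] derivation_1[OF d] derivation_uminus[OF d]
    unfolding is_subring_def is_derivation_def by auto
  then have "generated_algebra f X \<subseteq> {z \<in> S. d z \<in> S}"
    by (rule generated_algebra_minimal) (use base gen in auto)
  then show ?thesis using z by auto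
qed

text \<open>Chain rule: \<open>c\<close> collects the derivatives of the coefficients, and only its
  membership in \<open>S\<close> matters later.\<close>

lemma derivation_poly:
  fixes f :: "'b::idom poly"
  assumes d: "is_derivation d" and S: "is_subring S"
    and "\<And>n. coeff f n \<in> S" "\<And>n. d (coeff f n) \<in> S" "x \<in> S"
  shows "\<exists>c\<in>S. d (poly f x) = c + poly (pderiv f) x * d x"
  using assms(3,4)
proof (induction f)
  case 0
  then show ?case using derivation_0[OF d] subring_closed(1)[OF S] by auto
next
  case (pCons a f)
  have "\<And>n. coeff f n \<in> S" "\<And>n. d (coeff f n) \<in> S" and a: "d a \<in> S"
    using pCons.prems(1)[of "Suc _"] pCons.prems(2)[of "Suc _"] pCons.prems(2)[of 0] by auto
  then obtain c where c: "c \<in> S" "d (poly f x) = c + poly (pderiv f) x * d x"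
    using pCons.IH by blast
  have "d (poly (pCons a f) x) = d a + (d x * poly f x + x * d (poly f x))"
    using d by (simp add: is_derivation_def)
  also have "\<dots> = (d a + x * c) + poly (pderiv (pCons a f)) x * d x"
    by (simp add: c(2) pderiv_pCons algebra_simps)
  finally show ?case using a c(1) assms(5) subring_closed(4,5)[OF S] by blast
qed

section \<open>Dickson's lemma\<close>

lemma nat_seq_mono_subseq:
  fixes g :: "nat \<Rightarrow> nat"
  shows "\<exists>f :: nat \<Rightarrow> nat. strict_mono f \<and> mono (g \<circ> f)"
proof -
  obtain f :: "nat \<Rightarrow> nat" where f: "strict_mono f" "monoseq (\<lambda>n. g (f n))"
    using seq_monosub by blast
  show ?thesis
  proof (cases "incseq (\<lambda>n. g (f n))")
    case True
    then show ?thesis using f(1) by (intro exI[of _ f]) (simp add: o_def)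
  next
    case False
    then have dec: "decseq (\<lambda>n. g (f n))" using f(2) monoseq_iff by blast
    \<comment> \<open>A decreasing sequence of naturals is constant from the place \<open>k\<close>
      of its minimum on, so shifting by \<open>k\<close> gives a monotone one.\<close>
    obtain k where k: "\<And>n. g (f k) \<le> g (f n)"
      using ex_has_least_nat[of "\<lambda>_. True" _ "\<lambda>n. g (f n)"] by auto
    have "g (f (n + k)) = g (f k)" for n
      using decseqD[OF dec, of k "n + k"] k[of "n + k"] by simp
    moreover have "strict_mono (\<lambda>n. f (n + k))"
      using f(1) by (simp add: strict_mono_def)
    ultimately show ?thesis by (intro exI[of _ "\<lambda>n. f (n + k)"]) (simp add: mono_def)
  qed
qed

lemma simultaneous_mono_subseq:
  fixes g :: "nat \<Rightarrow> 'j \<Rightarrow> nat"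
  assumes "finite J"
  shows "\<exists>f :: nat \<Rightarrow> nat. strict_mono f \<and> (\<forall>j\<in>J. mono (\<lambda>n. g (f n) j))"
  using assms
proof (induction J)
  case empty
  show ?case by (rule exI[of _ "\<lambda>n. n"]) (simp add: strict_mono_def)
next
  case (insert i J)
  then obtain f :: "nat \<Rightarrow> nat" where f: "strict_mono f" "\<forall>j\<in>J. mono (\<lambda>n. g (f n) j)" by blast
  obtain h :: "nat \<Rightarrow> nat" where h: "strict_mono h" "mono ((\<lambda>n. g (f n) i) \<circ> h)"
    using nat_seq_mono_subseq by blast
  have "strict_mono (f \<circ> h)" using f(1) h(1) by (rule strict_mono_o)
  moreover have "mono (\<lambda>n. g (f (h n)) j)" if "j \<in> J" for j
    using f(2) that strict_mono_mono[OF h(1)] by (auto simp: mono_def)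
  ultimately show ?case using h(2) by (intro exI[of _ "f \<circ> h"]) (simp add: o_def)
qed

text \<open>\<open>T\<close> consists of the minimal members of \<open>S\<close>. Were it infinite,
  a sequence of distinct members would have a subsequence increasing in every count, hence two
  comparable members, against minimality.\<close>

lemma dickson_multiset:
  assumes J: "finite J" and S: "\<And>M. M \<in> S \<Longrightarrow> set_mset M \<subseteq> J"
  shows "\<exists>T\<subseteq>S. finite T \<and> (\<forall>M\<in>S. \<exists>t\<in>T. t \<subseteq># M)"
proof -
  define T where "T = {t \<in> S. \<forall>u\<in>S. u \<subseteq># t \<longrightarrow> u = t}"
  have "\<exists>t\<in>T. t \<subseteq># M" if "M \<in> S" for M
    using that
  proof (induction M rule: measure_induct_rule[of size])
    case (less M)
    show ?case
    proof (cases "M \<in> T")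
      case False
      then obtain u where u: "u \<in> S" "u \<subset># M"
        using less.prems unfolding T_def subset_mset_def by auto
      then obtain t where "t \<in> T" "t \<subseteq># u" using less.IH mset_subset_size by blast
      then show ?thesis using u(2) by (meson subset_mset.dual_order.trans subset_mset.less_imp_le)
    qed auto
  qed
  moreover have "finite T"
  proof (rule ccontr)
    assume "infinite T"
    then obtain g :: "nat \<Rightarrow> 'a multiset" where g: "inj g" "range g \<subseteq> T"
      using infinite_countable_subset by blast
    obtain f :: "nat \<Rightarrow> nat" where f: "strict_mono f" "\<forall>j\<in>J. mono (\<lambda>n. count (g (f n)) j)"
      using simultaneous_mono_subseq[OF J, of "\<lambda>n. count (g n)"] by blast
    have gT: "g n \<in> T" for n using g(2) by auto
    have "g (f 0) \<subseteq># g (f 1)"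
    proof (rule mset_subset_eqI)
      fix a show "count (g (f 0)) a \<le> count (g (f 1)) a"
      proof (cases "a \<in> J")
        case True
        then show ?thesis using f(2) by (simp add: mono_def)
      next
        case False
        then have "a \<notin># g (f 0)" using S gT unfolding T_def by blast
        then show ?thesis by (simp add: not_in_iff)
      qed
    qed
    then have "g (f 0) = g (f 1)" using gT[of "f 0"] gT[of "f 1"] unfolding T_def by blast
    then have "f 0 = f 1" using g(1) by (simp add: inj_eq)
    then show False using strict_monoD[OF f(1), of 0 1] by simp
  qed
  moreover have "T \<subseteq> S" unfolding T_def by auto
  ultimately show ?thesis by (intro exI[of _ T]) simp
qed

section \<open>Ranked families of derivatives\<close>

text \<open>An index in \<open>U\<close> stands for a formal derivative, \<open>x\<close> gives its
  value in the algebra, and \<open>D j\<close> is formal differentiation; distinct indices may share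
  a value. Since \<open>r\<close> is injective into the naturals, each index has only finitely many
  predecessors.\<close>

locale ranked_differential_algebra =
  fixes \<phi> :: "'a::comm_ring_1 \<Rightarrow> 'b::idom"
    and J :: "'j set" and \<delta> :: "'j \<Rightarrow> 'b \<Rightarrow> 'b"
    and U :: "'u set" and D :: "'j \<Rightarrow> 'u \<Rightarrow> 'u" and x :: "'u \<Rightarrow> 'b" and r :: "'u \<Rightarrow> nat"
  assumes hom: "is_ring_hom \<phi>"
    and deriv: "j \<in> J \<Longrightarrow> is_derivation (\<delta> j)"
    and deriv_base: "j \<in> J \<Longrightarrow> \<delta> j (\<phi> a) \<in> range \<phi>"
    and D_in: "j \<in> J \<Longrightarrow> u \<in> U \<Longrightarrow> D j u \<in> U"
    and x_D: "j \<in> J \<Longrightarrow> u \<in> U \<Longrightarrow> x (D j u) = \<delta> j (x u)"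
    and r_inj: "inj_on r U"
    and r_D: "j \<in> J \<Longrightarrow> u \<in> U \<Longrightarrow> r u < r (D j u)"
    and r_mono: "j \<in> J \<Longrightarrow> u \<in> U \<Longrightarrow> v \<in> U \<Longrightarrow> r u < r v \<Longrightarrow> r (D j u) < r (D j v)"
    and char_0: "of_nat (Suc n) \<noteq> (0::'b)"
    and generates: "generated_algebra \<phi> (x ` U) = UNIV"
    and dickson: "S \<subseteq> U \<Longrightarrow> \<exists>T\<subseteq>S. finite T \<and> S \<subseteq> derivatives J D T"
begin

section \<open>The filtration by rank\<close>

definition R :: "nat \<Rightarrow> 'b set" where
  "R n = generated_algebra \<phi> (x ` {v \<in> U. r v < n})"

lemma subring_R: "is_subring (R n)"
  unfolding R_def by (rule is_subring_generated_algebra)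

lemma R_mono: "m \<le> n \<Longrightarrow> R m \<subseteq> R n"
  unfolding R_def by (intro generated_algebra_mono) auto

lemma x_in_R: "u \<in> U \<Longrightarrow> r u < n \<Longrightarrow> x u \<in> R n"
  unfolding R_def by (intro generated_algebra_gen) auto

text \<open>The ranking is preserved by \<open>D j\<close>, so the derivative of a predecessor of
  \<open>u\<close> is the value of a predecessor of \<open>D j u\<close>.\<close>

lemma deriv_R:
  assumes "j \<in> J" "u \<in> U" "z \<in> R (r u)"
  shows "\<delta> j z \<in> R (r (D j u))"
proof (rule derivation_into_subring[OF deriv[OF assms(1)] subring_R])
  show "z \<in> generated_algebra \<phi> (x ` {v \<in> U. r v < r u})" using assms(3) unfolding R_def .
  show base: "\<phi> a \<in> R (r (D j u))" for a unfolding R_def by (rule generated_algebra_base)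
  show "\<delta> j (\<phi> a) \<in> R (r (D j u))" for a using deriv_base[OF assms(1), of a] base by auto
  fix y assume "y \<in> x ` {v \<in> U. r v < r u}"
  then obtain v where v: "v \<in> U" "r v < r u" "y = x v" by auto
  show "y \<in> R (r (D j u))"
    using v r_D[OF assms(1,2)] by (auto intro: x_in_R)
  have "x (D j v) \<in> R (r (D j u))"
    by (intro x_in_R D_in r_mono assms v)
  then show "\<delta> j y \<in> R (r (D j u))" using v assms(1) by (simp add: x_D)
qed

section \<open>Leaders and their separants\<close>

definition leader :: "'u \<Rightarrow> bool" where
  "leader u \<longleftrightarrow> u \<in> U \<and> (\<exists>f. f \<noteq> 0 \<and> (\<forall>n. coeff f n \<in> R (r u)) \<and> poly f (x u) = 0)"

text \<open>The witness is the derivative of a relation \<open>f\<close> of minimal degree,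
  evaluated at \<open>x u\<close>. The bound is \<open>Suc (r u)\<close> because this value may
  involve \<open>x u\<close> itself.\<close>

lemma separant_exists:
  assumes "leader u"
  shows "\<exists>s. s \<noteq> 0 \<and> s \<in> R (Suc (r u)) \<and> (\<forall>j\<in>J. s * x (D j u) \<in> R (r (D j u)))"
proof -
  define P where "P f \<longleftrightarrow> f \<noteq> 0 \<and> (\<forall>n. coeff f n \<in> R (r u)) \<and> poly f (x u) = 0" for f
  have uU: "u \<in> U" and "\<exists>f. P f" using assms unfolding leader_def P_def by auto
  then obtain f where f: "P f" and min: "\<And>g. P g \<Longrightarrow> degree f \<le> degree g"
    using ex_has_least_nat[of P _ degree] by blast
  have deg: "degree f \<noteq> 0"
  proof
    assume "degree f = 0"
    then obtain a where "f = [:a:]" by (rule degree_eq_zeroE)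
    then show False using f unfolding P_def by auto
  qed
  let ?s = "poly (pderiv f) (x u)"
  have coeff': "coeff (pderiv f) n \<in> R (r u)" for n
    unfolding coeff_pderiv using f unfolding P_def
    by (intro subring_closed(5)[OF subring_R] subring_of_nat[OF subring_R]) auto
  have "?s \<noteq> 0"
  proof
    assume "?s = 0"
    \<comment> \<open>This coefficient is the degree times the leading coefficient of
      \<open>f\<close>, nonzero in a domain of characteristic zero. A vanishing separant would thus
      make \<open>pderiv f\<close> a relation of smaller degree.\<close>
    have "coeff (pderiv f) (degree f - 1) \<noteq> 0"
      using deg char_0[of "degree f - 1"] by (auto simp: coeff_pderiv)
    then have "P (pderiv f)" using \<open>?s = 0\<close> coeff' unfolding P_def by auto
    then have "degree f \<le> degree (pderiv f)" by (rule min)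
    moreover have "degree (pderiv f) \<le> degree f - 1"
      by (rule degree_le) (auto simp: coeff_pderiv coeff_eq_0)
    ultimately show False using deg by simp
  qed
  moreover have s: "?s \<in> R (Suc (r u))"
    using coeff' R_mono[of "r u" "Suc (r u)"] uU
    by (intro subring_poly[OF subring_R] x_in_R) auto
  moreover have "?s * x (D j u) \<in> R (r (D j u))" if j: "j \<in> J" for j
  proof -
    have "r u < r (D j u)" using r_D[OF j uU] .
    then have "\<exists>c\<in>R (r (D j u)). \<delta> j (poly f (x u)) = c + ?s * \<delta> j (x u)"
      using f deriv_R[OF j uU] R_mono[of "r u" "r (D j u)"] uU unfolding P_def
      by (intro derivation_poly[OF deriv[OF j] subring_R] x_in_R) auto
    then obtain c where c: "c \<in> R (r (D j u))" "\<delta> j (poly f (x u)) = c + ?s * \<delta> j (x u)" by blast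
    have "\<delta> j (poly f (x u)) = 0" using f derivation_0[OF deriv[OF j]] unfolding P_def by simp
    then have "?s * x (D j u) = - c" using c(2) x_D[OF j uU]
      by (simp add: eq_neg_iff_add_eq_0 add.commute)
    then show ?thesis using subring_closed(3)[OF subring_R c(1)] by simp
  qed
  ultimately show ?thesis by blast
qed

definition separant :: "'u \<Rightarrow> 'b" where
  "separant u =
     (SOME s. s \<noteq> 0 \<and> s \<in> R (Suc (r u)) \<and> (\<forall>j\<in>J. s * x (D j u) \<in> R (r (D j u))))"

lemma separant:
  assumes "leader u"
  shows "separant u \<noteq> 0" "separant u \<in> R (Suc (r u))"
    "j \<in> J \<Longrightarrow> separant u * x (D j u) \<in> R (r (D j u))"
  using someI_ex[OF separant_exists[OF assms]] unfolding separant_def by auto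

text \<open>The Leibniz rule applied to \<open>s * x u\<close> shows that the same multiplier
  \<open>s\<close> keeps working after further differentiation.\<close>

lemma separant_derivative:
  assumes "j \<in> J" "u \<in> U" "s \<in> R (r u)" "s * x u \<in> R (r u)"
  shows "s * x (D j u) \<in> R (r (D j u))"
proof -
  let ?R = "R (r (D j u))"
  have lt: "r u < r (D j u)" using r_D assms by blast
  have "\<delta> j (s * x u) = \<delta> j s * x u + s * x (D j u)"
    using deriv[OF assms(1)] assms(1,2) unfolding is_derivation_def by (simp add: x_D)
  then have "s * x (D j u) = \<delta> j (s * x u) - \<delta> j s * x u" by simp
  moreover have "\<delta> j (s * x u) \<in> ?R" "\<delta> j s \<in> ?R" using assms deriv_R by blast+
  moreover have "x u \<in> ?R" using assms(2) lt by (rule x_in_R)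
  ultimately show ?thesis
    using subring_minus[OF subring_R] subring_closed(5)[OF subring_R] by metis
qed

text \<open>Members of \<open>T\<close> only satisfy an algebraic relation. The first
  differentiation makes the relation linear with the separant as coefficient, and
  \<open>separant_derivative\<close> carries this on to all later ones.\<close>

lemma derivatives_of_leaders:
  assumes "w \<in> derivatives J D T" "\<And>t. t \<in> T \<Longrightarrow> leader t"
  shows "w \<in> T \<or>
    (w \<in> U \<and> (\<exists>t\<in>T. r t < r w \<and> separant t * x w \<in> R (r w)))"
  using assms(1)
proof induction
  case (base w)
  then show ?case by blast
next
  case (step w j)
  show ?case
  proof (cases "w \<in> T")
    case True
    then have "leader w" "w \<in> U" using assms(2) unfolding leader_def by blast+
    then show ?thesis using True step.hyps(2) separant(3) D_in r_D by blast
  next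
    case False
    then obtain t where t: "w \<in> U" "t \<in> T" "r t < r w" "separant t * x w \<in> R (r w)"
      using step.IH by blast
    have "separant t \<in> R (r w)"
      using separant(2)[OF assms(2)[OF t(2)]] R_mono[of "Suc (r t)" "r w"] t(3) by auto
    then have "separant t * x (D j w) \<in> R (r (D j w))"
      using separant_derivative step.hyps(2) t by blast
    moreover have "r t < r (D j w)" using r_D[OF step.hyps(2) t(1)] t(3) by simp
    ultimately show ?thesis using t step.hyps(2) D_in by blast
  qed
qed

lemma finitely_many_leaders_suffice:
  "\<exists>N s. s \<noteq> 0 \<and> s \<in> R N \<and> (\<forall>w. leader w \<longrightarrow> N \<le> r w \<longrightarrow> s * x w \<in> R (r w))"
proof -
  obtain T where T: "T \<subseteq> {u. leader u}" "finite T" "{u. leader u} \<subseteq> derivatives J D T"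
    using dickson[of "{u. leader u}"] unfolding leader_def by auto
  \<comment> \<open>The sum dominates each rank, and \<open>Suc\<close> makes the bound strict, so
    that all separants lie in \<open>R N\<close>.\<close>
  define N where "N = Suc (\<Sum>t\<in>T. r t)"
  define s where "s = (\<Prod>t\<in>T. separant t)"
  have lt: "r t < N" if "t \<in> T" for t
    unfolding N_def using member_le_sum[OF that, of r] T(2) by (simp add: less_Suc_eq_le)
  have sepN: "separant t \<in> R N" if "t \<in> T" for t
    using separant(2)[of t] T(1) that R_mono[of "Suc (r t)" N] lt[OF that] by auto
  have "s * x w \<in> R (r w)" if w: "leader w" "N \<le> r w" for w
  proof -
    \<comment> \<open>Rank at least \<open>N\<close> rules out the members of \<open>T\<close>, so
      \<open>w\<close> is a proper derivative of one of them.\<close>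
    have "w \<notin> T" using lt w(2) by fastforce
    then obtain t where t: "t \<in> T" "separant t * x w \<in> R (r w)"
      using derivatives_of_leaders[of w T] T w(1) by blast
    \<comment> \<open>The other factors of \<open>s\<close> lie in \<open>R N\<close>, hence in
      \<open>R (r w)\<close>, and do no harm.\<close>
    have "(\<Prod>t\<in>T - {t}. separant t) \<in> R (r w)"
      using sepN R_mono[OF w(2)] by (intro subring_prod[OF subring_R]) auto
    then have "(\<Prod>t\<in>T - {t}. separant t) * (separant t * x w) \<in> R (r w)"
      using t(2) subring_closed(5)[OF subring_R] by blast
    moreover have "s = separant t * (\<Prod>t\<in>T - {t}. separant t)"
      unfolding s_def using T(2) t(1) by (rule prod.remove)
    ultimately show ?thesis by (simp add: mult_ac)
  qed
  moreover have "s \<noteq> 0" unfolding s_def using T separant(1) by auto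
  moreover have "s \<in> R N" unfolding s_def using sepN by (intro subring_prod[OF subring_R]) auto
  ultimately show ?thesis by blast
qed

section \<open>Algebraic independence of the non-leaders\<close>

definition free_below :: "nat \<Rightarrow> nat \<Rightarrow> 'u set" where
  "free_below N k = {v \<in> U. \<not> leader v \<and> N \<le> r v \<and> r v < k}"

lemma finite_rank_below: "finite {v \<in> U. r v < k}"
proof (rule finite_imageD)
  show "finite (r ` {v \<in> U. r v < k})" by (rule finite_subset[of _ "{..<k}"]) auto
  show "inj_on r {v \<in> U. r v < k}" by (rule inj_on_subset[OF r_inj]) auto
qed

lemma finite_free_below: "finite (free_below N k)"
  unfolding free_below_def by (rule finite_subset[OF _ finite_rank_below]) auto

text \<open>A polynomial in the variables of rank below \<open>k\<close> is given by a finite set \<open>M\<close> of names of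
  monomials with coefficients \<open>c\<close> and exponents \<open>e\<close>.  This shape survives the passage to the
  coefficients of the powers of the last variable, which only shrinks \<open>M\<close>.\<close>

lemma nonleaders_independent:
  assumes "finite M" "\<And>m. m \<in> M \<Longrightarrow> c m \<in> R N"
    and "\<And>m m'. m \<in> M \<Longrightarrow> m' \<in> M \<Longrightarrow> m \<noteq> m' \<Longrightarrow> \<exists>v\<in>free_below N k. e m v \<noteq> e m' v"
    and "(\<Sum>m\<in>M. c m * (\<Prod>v\<in>free_below N k. x v ^ e m v)) = 0"
    and "m \<in> M"
  shows "c m = 0"
  using assms
proof (induction k arbitrary: M m)
  case 0
  have *: "free_below N 0 = {}" unfolding free_below_def by simp
  \<comment> \<open>Without variables nothing can tell two monomials apart, so the sum is the single
    term \<open>c m\<close>.\<close>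
  then have "M = {m}" using "0.prems"(3,5) by blast
  then show ?case using "0.prems"(4) * by simp
next
  case (Suc k)
  show ?case
  proof (cases "\<exists>v. v \<in> free_below N (Suc k) \<and> r v = k")
    case False
    have "free_below N (Suc k) = free_below N k"
      using False unfolding free_below_def by (auto simp: less_Suc_eq)
    then show ?thesis using Suc.IH[of M m] Suc.prems by simp
  next
    case True
    then obtain v where v: "v \<in> free_below N (Suc k)" "r v = k" by blast
    then have vU: "v \<in> U" "\<not> leader v" "N \<le> k" unfolding free_below_def by auto
    have split: "free_below N (Suc k) = insert v (free_below N k)"
      using v vU r_inj unfolding free_below_def by (auto simp: less_Suc_eq inj_on_def)
    have vn: "v \<notin> free_below N k" using v(2) unfolding free_below_def by simp
    \<comment> \<open>The relation is read as a polynomial \<open>f\<close> in the last variable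
      \<open>x v\<close>; \<open>q m\<close> is the part of a term that is free of
      \<open>v\<close>.\<close>
    define q where "q m = c m * (\<Prod>w\<in>free_below N k. x w ^ e m w)" for m
    define f where "f = (\<Sum>m\<in>M. monom (q m) (e m v))"
    have coeff_f: "coeff f i = (\<Sum>m\<in>{m \<in> M. e m v = i}. q m)" for i
      unfolding f_def coeff_sum using Suc.prems(1)
      by (simp add: sum.inter_filter)
    have "q m \<in> R k" if "m \<in> M" for m
      unfolding q_def using Suc.prems(2)[OF that] R_mono[OF vU(3)]
      by (intro subring_closed(5)[OF subring_R] subring_prod[OF subring_R]
            subring_power[OF subring_R] x_in_R) (auto simp: free_below_def)
    then have "coeff f i \<in> R k" for i
      unfolding coeff_f by (intro subring_sum[OF subring_R]) auto
    moreover have "poly f (x v) = 0"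
      using Suc.prems(4) vn finite_free_below
      unfolding split f_def poly_sum poly_monom q_def
      by (simp add: mult_ac)
    \<comment> \<open>Otherwise \<open>f\<close> would make \<open>v\<close> algebraic over
      \<open>R k\<close>, that is, a leader.\<close>
    ultimately have "f = 0" using vU v(2) unfolding leader_def by auto
    show ?thesis
    \<comment> \<open>The induction hypothesis is applied to one coefficient of \<open>f\<close>.
      Its terms agree in the exponent of \<open>v\<close>, so they still differ at a variable of
      lower rank.\<close>
    proof (rule Suc.IH[of "{m' \<in> M. e m' v = e m v}"])
      show "(\<Sum>m\<in>{m' \<in> M. e m' v = e m v}. c m * (\<Prod>v\<in>free_below N k. x v ^ e m v)) = 0"
        using coeff_f[of "e m v"] \<open>f = 0\<close> unfolding q_def by simp
      fix m1 m2 assume "m1 \<in> {m' \<in> M. e m' v = e m v}" "m2 \<in> {m' \<in> M. e m' v = e m v}" "m1 \<noteq> m2"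
      then show "\<exists>w\<in>free_below N k. e m1 w \<noteq> e m2 w"
        using Suc.prems(3)[of m1 m2] unfolding split by auto
    qed (use Suc.prems in auto)
  qed
qed

text \<open>If a lower-ranked \<open>a\<close> had the same value as \<open>b\<close>, the linear
  polynomial with root \<open>x a\<close> would make \<open>b\<close> a leader. Thus the values of
  non-leaders can serve as names of variables.\<close>

lemma x_nonleader_inj:
  assumes "u \<in> U" "v \<in> U" "\<not> leader u" "\<not> leader v" "x u = x v"
  shows "u = v"
proof -
  have "\<not> r a < r b" if "a \<in> U" "b \<in> U" "x a = x b" "\<not> leader b" for a b
  proof
    assume "r a < r b"
    then have xa: "x a \<in> R (r b)" using that x_in_R by blast
    have "coeff [:- x a, 1:] n \<in> R (r b)" for n
      using xa subring_closed[OF subring_R[of "r b"]]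
      by (auto simp: coeff_pCons split: nat.split)
    moreover have "poly [:- x a, 1:] (x b) = 0" using that by simp
    ultimately show False using that unfolding leader_def by (metis one_neq_zero pCons_eq_0_iff)
  qed
  then have "r u = r v" using assms by (metis linorder_neqE_nat)
  then show ?thesis using r_inj assms by (auto dest: inj_onD)
qed

end

section \<open>Passing to the localization\<close>

lemma is_ring_hom_to_fract: "is_ring_hom to_fract"
  unfolding is_ring_hom_def by simp

lemma to_fract_power: "to_fract (a ^ n) = to_fract a ^ n"
  by (induction n) simp_all

lemma to_fract_prod: "to_fract (prod f A) = (\<Prod>a\<in>A. to_fract (f a))"
  by (induction A rule: infinite_finite_induct) simp_all

text \<open>Used with \<open>S = UNIV\<close> for the localization itself, and with
  \<open>S = R N\<close> to control the numerators of elements of \<open>C\<close>.\<close>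

lemma is_subring_fractions:
  fixes s :: "'b::idom"
  assumes "s \<noteq> 0" and S: "is_subring S" and "s \<in> S"
  shows "is_subring {Fract b (s ^ n) | b n. b \<in> S}"
  unfolding is_subring_def
proof (intro conjI ballI)
  let ?L = "{Fract b (s ^ n) | b n. b \<in> S}"
  show "0 \<in> ?L" using subring_closed(1)[OF S]
    by (force simp: Zero_fract_def intro: exI[of _ 0])
  show "1 \<in> ?L" using subring_closed(2)[OF S]
    by (force simp: One_fract_def intro: exI[of _ 0])
  fix y assume "y \<in> ?L"
  then obtain b n where y: "y = Fract b (s ^ n)" "b \<in> S" by blast
  then show "- y \<in> ?L" using subring_closed(3)[OF S] by force
  fix z assume "z \<in> ?L"
  then obtain c m where z: "z = Fract c (s ^ m)" "c \<in> S" by blast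
  have "y + z = Fract (b * s ^ m + c * s ^ n) (s ^ (n + m))"
    using y z assms(1) by (simp add: power_add)
  then show "y + z \<in> ?L" using y(2) z(2) subring_closed(4,5)[OF S] subring_power[OF S assms(3)]
    by blast
  have "y * z = Fract (b * c) (s ^ (n + m))" using y z by (simp add: power_add)
  then show "y * z \<in> ?L" using y(2) z(2) subring_closed(5)[OF S] by blast
qed

lemma localization_away_eq: "localization_away s = {Fract b (s ^ n) | b n. b \<in> UNIV}"
  unfolding localization_away_def by simp

lemma to_fract_in_localization: "to_fract b \<in> localization_away s"
  unfolding localization_away_def to_fract_def by (force intro: exI[of _ 0])

context ranked_differential_algebra
begin

theorem localization_is_polynomial_ring:
  "\<exists>s C Y. s \<noteq> 0 \<and> C \<subseteq> localization_away s \<and>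
     finitely_generated_subalgebra (to_localization \<phi>) C \<and>
     Y \<subseteq> localization_away s \<and> countable Y \<and>
     polynomial_ring_over (localization_away s) C Y"
proof -
  obtain N s where s: "s \<noteq> 0" "s \<in> R N"
    and redundant: "\<And>w. leader w \<Longrightarrow> N \<le> r w \<Longrightarrow> s * x w \<in> R (r w)"
    using finitely_many_leaders_suffice by blast
  \<comment> \<open>These generate \<open>R N\<close> with the inverse of \<open>s\<close> adjoined;
    the set is finite because only finitely many indices have rank below \<open>N\<close>.\<close>
  define F where "F = insert (Fract 1 s) (to_fract ` x ` {v \<in> U. r v < N})"
  define C where "C = generated_algebra (to_localization \<phi>) F"
  define Z where "Z = {v \<in> U. \<not> leader v \<and> N \<le> r v}"
  define Y where "Y = (\<lambda>v. to_fract (x v)) ` Z"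
  define H where "H = is_subring hull (C \<union> Y)"
  have subL: "is_subring (localization_away s)"
    unfolding localization_away_eq using s(1) by (intro is_subring_fractions) (auto simp: is_subring_def)
  have subC: "is_subring C" unfolding C_def by (rule is_subring_generated_algebra)
  have subH: "is_subring H" unfolding H_def by (rule is_subring_hull)
  have inv_L: "Fract 1 s \<in> localization_away s"
    unfolding localization_away_def by (force intro: exI[of _ 1])
  have CL: "C \<subseteq> localization_away s"
    unfolding C_def using subL inv_L
    by (intro generated_algebra_minimal) (auto simp: F_def to_localization_def to_fract_in_localization
        simp flip: to_fract_def)
  have YL: "Y \<subseteq> localization_away s" unfolding Y_def by (auto simp: to_fract_in_localization)
  have "finite F" unfolding F_def using finite_rank_below by simp
  then have fg: "finitely_generated_subalgebra (to_localization \<phi>) C"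
    unfolding finitely_generated_subalgebra_def C_def by blast
  have "countable U" by (rule countableI'[OF r_inj])
  then have "countable Z" unfolding Z_def by (rule countable_subset[rotated]) auto
  then have cY: "countable Y" unfolding Y_def by simp

  have CH: "C \<subseteq> H" and YH: "Y \<subseteq> H"
    unfolding H_def by (meson hull_subset le_sup_iff)+
  have phiH: "to_fract (\<phi> a) \<in> H" for a
    using CH generated_algebra_base[of "to_localization \<phi>" a F]
    unfolding C_def to_localization_def to_fract_def by auto
  have FH: "F \<subseteq> H" using CH generated_algebra_gen unfolding C_def by blast
  have vimH: "is_subring (to_fract -` H)"
    by (rule is_subring_vimage[OF is_ring_hom_to_fract subH])
  have xH: "to_fract (x v) \<in> H" if "v \<in> U" for v
    using that
  proof (induction v rule: measure_induct_rule[of r])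
    case (less v)
    consider "r v < N" | "N \<le> r v" "\<not> leader v" | "N \<le> r v" "leader v" by linarith
    then show ?case
    proof cases
      case 1
      then show ?thesis using FH less.prems unfolding F_def by auto
    next
      case 2
      then show ?thesis using YH less.prems unfolding Y_def Z_def by auto
    next
      case 3
      \<comment> \<open>By induction on the rank all generators of \<open>R (r v)\<close> land in
        \<open>H\<close>, hence so does \<open>s * x v\<close>; multiplying by the inverse of
        \<open>s\<close> recovers \<open>x v\<close>.\<close>
      have "R (r v) \<subseteq> to_fract -` H"
        unfolding R_def using phiH less.IH
        by (intro generated_algebra_minimal[OF vimH]) auto
      then have "to_fract (s * x v) \<in> H" using redundant[OF 3(2,1)] by auto
      moreover have "Fract 1 s \<in> H" using FH unfolding F_def by auto
      ultimately have "Fract 1 s * to_fract (s * x v) \<in> H" using subring_closed(5)[OF subH] by blast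
      moreover have "Fract 1 s * to_fract (s * x v) = to_fract (x v)"
        using s(1) by (simp add: Fract_conv_to_fract)
      ultimately show ?thesis by (simp only:)
    qed
  qed
  have BH: "to_fract b \<in> H" for b
  proof -
    have "generated_algebra \<phi> (x ` U) \<subseteq> to_fract -` H"
      using phiH xH by (intro generated_algebra_minimal[OF vimH]) auto
    then show ?thesis using generates by auto
  qed
  have "localization_away s \<subseteq> H"
  proof
    fix y assume "y \<in> localization_away s"
    then obtain b n where y: "y = Fract b (s ^ n)" unfolding localization_away_def by blast
    have "Fract 1 (s ^ n) = Fract 1 s ^ n"
      by (simp add: Fract_conv_to_fract to_fract_power power_divide)
    then have "Fract 1 (s ^ n) \<in> H"
      using FH subring_power[OF subH] unfolding F_def by auto
    then have "to_fract b * Fract 1 (s ^ n) \<in> H" using BH subring_closed(5)[OF subH] by blast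
    then show "y \<in> H" using y by (simp add: Fract_conv_to_fract)
  qed
  moreover have "H \<subseteq> localization_away s"
    unfolding H_def using CL YL subL by (intro hull_minimal) auto
  ultimately have gen: "localization_away s = is_subring hull (C \<union> Y)" unfolding H_def by blast

  \<comment> \<open>Prepares the passage from a relation over \<open>C\<close> to one over
    \<open>R N\<close>, where \<open>nonleaders_independent\<close> applies.\<close>
  have C_fractions: "C \<subseteq> {Fract b (s ^ n) | b n. b \<in> R N}"
    unfolding C_def
  proof (intro generated_algebra_minimal is_subring_fractions s subring_R)
    show "to_localization \<phi> a \<in> {Fract b (s ^ n) | b n. b \<in> R N}" for a
      unfolding to_localization_def R_def
      using generated_algebra_base[of \<phi> a] by (force intro: exI[of _ 0])
    have "Fract 1 s \<in> {Fract b (s ^ n) | b n. b \<in> R N}"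
      using subring_closed(2)[OF subring_R] by (force intro: exI[of _ 1])
    moreover have "to_fract (x v) \<in> {Fract b (s ^ n) | b n. b \<in> R N}" if "v \<in> U" "r v < N" for v
      using x_in_R[OF that] unfolding to_fract_def by (force intro: exI[of _ 0])
    ultimately show "F \<subseteq> {Fract b (s ^ n) | b n. b \<in> R N}" unfolding F_def by auto
  qed
  have clear_denominator: "\<exists>n b. b \<in> R N \<and> to_fract s ^ n * y = to_fract b" if y: "y \<in> C" for y
  proof -
    obtain b n where "y = Fract b (s ^ n)" "b \<in> R N"
      using C_fractions y by blast
    moreover have "to_fract (s ^ n) * Fract b (s ^ n) = to_fract b" using s(1) by (simp add: Fract_conv_to_fract)
    ultimately show ?thesis unfolding to_fract_power by blast
  qed
  have "algebraically_independent C Y"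
    unfolding algebraically_independent_def
  proof (intro allI impI)
    fix p :: "('b fract \<Rightarrow>\<^sub>0 nat) \<Rightarrow>\<^sub>0 'b fract"
    assume *: "range (Poly_Mapping.lookup p) \<subseteq> C \<and>
      (\<forall>m\<in>Poly_Mapping.keys p. Poly_Mapping.keys m \<subseteq> Y) \<and> poly_eval (\<lambda>v. v) p = 0"
    define M where "M = Poly_Mapping.keys p"
    have finM: "finite M" unfolding M_def by simp
    have "\<forall>m. \<exists>n b. b \<in> R N \<and> to_fract s ^ n * Poly_Mapping.lookup p m = to_fract b"
      using clear_denominator * by blast
    then obtain n0 b0 where nb: "\<And>m. b0 m \<in> R N"
      "\<And>m. to_fract s ^ n0 m * Poly_Mapping.lookup p m = to_fract (b0 m)" by metis
    \<comment> \<open>The sum dominates every \<open>n0 m\<close>, so \<open>s ^ n\<close> clears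
      all denominators at once.\<close>
    define n where "n = (\<Sum>m\<in>M. n0 m)"
    define c where "c m = s ^ (n - n0 m) * b0 m" for m
    have c: "c m \<in> R N" for m
      unfolding c_def using nb(1) s(2)
      by (intro subring_closed(5)[OF subring_R] subring_power[OF subring_R])
    have emb_c: "to_fract (c m) = to_fract s ^ n * Poly_Mapping.lookup p m" if "m \<in> M" for m
    proof -
      have le: "n0 m \<le> n" unfolding n_def using member_le_sum[OF that, of n0] finM by simp
      have "to_fract (c m) = to_fract s ^ (n - n0 m) * to_fract (b0 m)"
        unfolding c_def to_fract_power[symmetric] by simp
      also have "\<dots> = to_fract s ^ (n - n0 m + n0 m) * Poly_Mapping.lookup p m"
        unfolding nb(2)[symmetric] power_add by (simp only: mult.assoc)
      finally show ?thesis using le by simp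
    qed
    \<comment> \<open>Only finitely many variables occur in \<open>p\<close>, so a single rank bound
      covers them.\<close>
    have "\<exists>k. \<forall>m\<in>M. Poly_Mapping.keys m \<subseteq> (\<lambda>v. to_fract (x v)) ` free_below N k"
    proof -
      have "finite (\<Union>m\<in>M. Poly_Mapping.keys m)" using finM by simp
      moreover have "(\<Union>m\<in>M. Poly_Mapping.keys m) \<subseteq> (\<lambda>v. to_fract (x v)) ` Z"
        using * unfolding M_def Y_def by blast
      ultimately obtain V where V: "V \<subseteq> Z" "finite V"
        "(\<Union>m\<in>M. Poly_Mapping.keys m) = (\<lambda>v. to_fract (x v)) ` V"
        by (meson finite_subset_image)
      have "r v < Suc (\<Sum>v\<in>V. r v)" if "v \<in> V" for v
        using member_le_sum[OF that, of r] V(2) by (simp add: less_Suc_eq_le)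
      then have "V \<subseteq> free_below N (Suc (\<Sum>v\<in>V. r v))"
        using V(1) unfolding free_below_def Z_def by auto
      then show ?thesis using V(3) by blast
    qed
    then obtain k where k: "\<And>m. m \<in> M \<Longrightarrow> Poly_Mapping.keys m \<subseteq> (\<lambda>v. to_fract (x v)) ` free_below N k"
      by blast
    have inj: "inj_on (\<lambda>v. to_fract (x v)) (free_below N k)"
      using x_nonleader_inj by (auto simp: inj_on_def to_fract_eq_iff free_below_def)
    define e where "e m v = Poly_Mapping.lookup m (to_fract (x v))"
      for m :: "'b fract \<Rightarrow>\<^sub>0 nat" and v
    have mono: "(\<Prod>y\<in>Poly_Mapping.keys m. y ^ Poly_Mapping.lookup m y) =
        to_fract (\<Prod>v\<in>free_below N k. x v ^ e m v)" if "m \<in> M" for m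
    proof -
      have "(\<Prod>y\<in>Poly_Mapping.keys m. y ^ Poly_Mapping.lookup m y) =
          (\<Prod>y\<in>(\<lambda>v. to_fract (x v)) ` free_below N k. y ^ Poly_Mapping.lookup m y)"
        using k[OF that] finite_free_below
        by (intro prod.mono_neutral_left) (auto simp: in_keys_iff)
      also have "\<dots> = (\<Prod>v\<in>free_below N k. to_fract (x v) ^ e m v)"
        unfolding prod.reindex[OF inj] e_def by simp
      finally show ?thesis by (simp add: to_fract_prod to_fract_power)
    qed
    have "to_fract (\<Sum>m\<in>M. c m * (\<Prod>v\<in>free_below N k. x v ^ e m v)) =
        (\<Sum>m\<in>M. to_fract (c m) * to_fract (\<Prod>v\<in>free_below N k. x v ^ e m v))"
      unfolding to_fract_sum by simp
    also have "\<dots> = (\<Sum>m\<in>M. to_fract s ^ n * (Poly_Mapping.lookup p m *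
        (\<Prod>y\<in>Poly_Mapping.keys m. y ^ Poly_Mapping.lookup m y)))"
      by (intro sum.cong refl) (simp only: emb_c mono mult.assoc)
    also have "\<dots> = to_fract s ^ n * poly_eval (\<lambda>v. v) p"
      unfolding poly_eval_def M_def by (simp only: sum_distrib_left)
    also have "\<dots> = to_fract 0" using * by simp
    finally have zero: "(\<Sum>m\<in>M. c m * (\<Prod>v\<in>free_below N k. x v ^ e m v)) = 0"
      unfolding to_fract_eq_iff .
    \<comment> \<open>All variables of these monomials come from \<open>free_below N k\<close>, so
      agreement of the exponents there forces equality.\<close>
    have sep: "\<exists>v\<in>free_below N k. e m v \<noteq> e m' v" if m: "m \<in> M" "m' \<in> M" "m \<noteq> m'" for m m'
    proof (rule ccontr)
      assume same: "\<not> ?thesis"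
      have "Poly_Mapping.lookup m y = Poly_Mapping.lookup m' y" for y
      proof (cases "y \<in> (\<lambda>v. to_fract (x v)) ` free_below N k")
        case True
        then show ?thesis using same unfolding e_def by auto
      next
        case False
        then have "y \<notin> Poly_Mapping.keys m" "y \<notin> Poly_Mapping.keys m'" using k m by blast+
        then show ?thesis by (simp add: in_keys_iff)
      qed
      then show False using m(3) by (metis poly_mapping_eqI)
    qed
    have "c m = 0" if "m \<in> M" for m
      using nonleaders_independent[of M c N k e, OF finM c sep zero that] .
    then have "Poly_Mapping.lookup p m = 0" if "m \<in> M" for m
      using emb_c[OF that] that s(1) by simp
    then have "Poly_Mapping.lookup p m = 0" for m
      unfolding M_def by (cases "m \<in> Poly_Mapping.keys p") (auto simp: in_keys_iff)
    then show "p = 0" by (intro poly_mapping_eqI) simp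
  qed
  then show ?thesis
    using s(1) CL fg YL cY gen unfolding polynomial_ring_over_def by blast
qed

end

section \<open>An orderly ranking of the derivatives\<close>

lemma finite_multisets_size_le:
  assumes "finite A"
  shows "finite {M. set_mset M \<subseteq> A \<and> size M \<le> n}"
proof -
  have "{M. set_mset M \<subseteq> A \<and> size M \<le> n} \<subseteq> mset ` {xs. set xs \<subseteq> A \<and> length xs \<le> n}"
  proof
    fix M assume M: "M \<in> {M. set_mset M \<subseteq> A \<and> size M \<le> n}"
    obtain xs where "mset xs = M" using ex_mset by blast
    then show "M \<in> mset ` {xs. set xs \<subseteq> A \<and> length xs \<le> n}" using M by force
  qed
  then show ?thesis using finite_lists_length_le[OF assms] by (meson finite_imageI finite_subset)
qed

text \<open>\<open>r\<close> counts predecessors, which is strictly monotone because all initial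
  segments are finite.\<close>

lemma nat_rank_exists:
  fixes \<kappa> :: "'u \<Rightarrow> 'k::linorder"
  assumes inj: "inj_on \<kappa> U" and fin: "\<And>u. u \<in> U \<Longrightarrow> finite {v \<in> U. \<kappa> v < \<kappa> u}"
  obtains r :: "'u \<Rightarrow> nat" where "inj_on r U"
    "\<And>u v. u \<in> U \<Longrightarrow> v \<in> U \<Longrightarrow> r u < r v \<longleftrightarrow> \<kappa> u < \<kappa> v"
proof -
  define r where "r u = card {v \<in> U. \<kappa> v < \<kappa> u}" for u
  have less: "r u < r v" if "u \<in> U" "v \<in> U" "\<kappa> u < \<kappa> v" for u v
    unfolding r_def using that by (intro psubset_card_mono fin) auto
  have iff: "r u < r v \<longleftrightarrow> \<kappa> u < \<kappa> v" if "u \<in> U" "v \<in> U" for u v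
  proof (cases "\<kappa> u" "\<kappa> v" rule: linorder_cases)
    case equal
    then show ?thesis by (simp add: r_def)
  qed (use less[OF that] less[OF that(2,1)] in auto)
  have "inj_on r U"
  proof (rule inj_onI)
    fix u v assume "u \<in> U" "v \<in> U" "r u = r v"
    then have "\<kappa> u = \<kappa> v" using less[of u v] less[of v u] by force
    then show "u = v" using inj \<open>u \<in> U\<close> \<open>v \<in> U\<close> by (auto dest: inj_onD)
  qed
  then show thesis using iff by (rule that)
qed

text \<open>Pairs are compared lexicographically: first the total order of the derivative, then the
  multiset order, then the generator index. Putting the size first leaves only finitely many
  predecessors when the index sets are finite.\<close>

definition orderly_key :: "nat multiset \<times> nat \<Rightarrow> nat \<times> nat multiset \<times> nat" where
  "orderly_key u = (size (fst u), u)"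

lemma orderly_rank_exists:
  fixes m n :: nat
  defines "U \<equiv> {M. set_mset M \<subseteq> {..<m}} \<times> {..<n}"
  obtains r :: "nat multiset \<times> nat \<Rightarrow> nat" where "inj_on r U"
    "\<And>u v. u \<in> U \<Longrightarrow> v \<in> U \<Longrightarrow> r u < r v \<longleftrightarrow> orderly_key u < orderly_key v"
proof (rule nat_rank_exists[of orderly_key U])
  show "inj_on orderly_key U" by (simp add: inj_on_def orderly_key_def)
  fix u assume "u \<in> U"
  have "{v \<in> U. orderly_key v < orderly_key u}
      \<subseteq> {M. set_mset M \<subseteq> {..<m} \<and> size M \<le> size (fst u)} \<times> {..<n}"
    unfolding U_def orderly_key_def by auto
  then show "finite {v \<in> U. orderly_key v < orderly_key u}"
    by (rule finite_subset) (simp add: finite_multisets_size_le)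
qed (rule that)

lemma derivatives_add_mset:
  assumes "(t, k) \<in> T" "set_mset K \<subseteq> J"
  shows "(K + t, k) \<in> derivatives J (\<lambda>j (M, k). (add_mset j M, k)) T"
  using assms(2)
proof (induction K)
  case empty
  then show ?case using assms(1) by (auto intro: derivatives.base)
next
  case (add j K)
  then have "(K + t, k) \<in> derivatives J (\<lambda>j (M, k). (add_mset j M, k)) T" "j \<in> J" by auto
  from derivatives.step[OF this] show ?case by simp
qed

text \<open>Dickson's lemma is applied separately for each of the finitely many generator indices
  \<open>k\<close>.\<close>

lemma dickson_indexed:
  fixes n :: nat
  assumes J: "finite J" and S: "S \<subseteq> {M. set_mset M \<subseteq> J} \<times> {..<n}"
  shows "\<exists>T\<subseteq>S. finite T \<and> S \<subseteq> derivatives J (\<lambda>j (M, k). (add_mset j M, k)) T"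
proof -
  have "\<exists>T\<subseteq>{M. (M, k) \<in> S}. finite T \<and> (\<forall>M\<in>{M. (M, k) \<in> S}. \<exists>t\<in>T. t \<subseteq># M)" for k
    using S by (intro dickson_multiset[OF J]) auto
  then obtain T where T: "\<And>k. T k \<subseteq> {M. (M, k) \<in> S}" "\<And>k. finite (T k)"
    "\<And>k M. (M, k) \<in> S \<Longrightarrow> \<exists>t\<in>T k. t \<subseteq># M"
    by (metis mem_Collect_eq)
  let ?T = "\<Union>k<n. T k \<times> {k}"
  have "S \<subseteq> derivatives J (\<lambda>j (M, k). (add_mset j M, k)) ?T"
  proof clarify
    fix M k assume Mk: "(M, k) \<in> S"
    then obtain t where t: "t \<in> T k" "t \<subseteq># M" using T(3) by blast
    have "k < n" "set_mset M \<subseteq> J" using Mk S by auto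
    then have "(M - t + t, k) \<in> derivatives J (\<lambda>j (M, k). (add_mset j M, k)) ?T"
      using t(1) by (intro derivatives_add_mset) (auto dest: in_diffD)
    then show "(M, k) \<in> derivatives J (\<lambda>j (M, k). (add_mset j M, k)) ?T" using t(2) by simp
  qed
  moreover have "?T \<subseteq> S" using T(1) by auto
  ultimately show ?thesis using T(2) by (intro exI[of _ ?T]) auto
qed

text \<open>The image of the rational inverse of \<open>Suc n\<close> inverts
  \<open>of_nat (Suc n)\<close> in the target, so its vanishing would give
  \<open>1 = 0\<close>.\<close>

lemma ritt_algebra_char_0:
  fixes \<phi> :: "'a::comm_ring_1 \<Rightarrow> 'b::comm_ring_1"
  assumes "is_ring_hom (h :: rat \<Rightarrow> 'a)" "is_ring_hom \<phi>"
  shows "of_nat (Suc n) \<noteq> (0::'b)"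
proof
  assume "of_nat (Suc n) = (0::'b)"
  define g where "g = \<phi> \<circ> h"
  have g: "g 1 = 1" "\<And>x y. g (x + y) = g x + g y" "\<And>x y. g (x * y) = g x * g y"
    using assms by (auto simp: is_ring_hom_def g_def)
  have "g (0 + 0) = g 0 + g 0" by (rule g(2))
  then have g0: "g 0 = 0" by simp
  have "g (of_nat k) = of_nat k" for k by (induction k) (simp_all add: g g0)
  then have "g (of_nat (Suc n) * inverse (of_nat (Suc n))) = 0"
    unfolding g(3) using \<open>of_nat (Suc n) = (0::'b)\<close> by (simp only: mult_zero_left)
  moreover have "of_nat (Suc n) * inverse (of_nat (Suc n)) = (1::rat)"
    by (rule right_inverse) (simp del: of_nat_Suc)
  ultimately show False using g(1) by simp
qed

section \<open>Formal derivatives of the generators as a ranked family\<close>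

theorem mainTheorem2:
  fixes I :: "'i set"
    and \<delta>A :: "'i \<Rightarrow> 'a::comm_ring_1 \<Rightarrow> 'a"
    and \<delta>B :: "'i \<Rightarrow> 'b::idom \<Rightarrow> 'b"
    and \<phi> :: "'a \<Rightarrow> 'b"
  assumes "ritt_algebra I \<delta>A"
    and "differential_algebra I \<delta>A \<delta>B \<phi>"
    and "differentially_finitely_generated I \<delta>B \<phi>"
  shows "\<exists>s C Y. s \<noteq> 0 \<and>
           C \<subseteq> localization_away s \<and>
           finitely_generated_subalgebra (to_localization \<phi>) C \<and>
           Y \<subseteq> localization_away s \<and> countable Y \<and>
           polynomial_ring_over (localization_away s) C Y"
proof -
  have hom: "is_ring_hom \<phi>" and comm: "\<And>i a. i \<in> I \<Longrightarrow> \<phi> (\<delta>A i a) = \<delta>B i (\<phi> a)"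
    and finI: "finite I" and der: "\<And>i. i \<in> I \<Longrightarrow> is_derivation (\<delta>B i)"
    and commute: "\<And>i j b. i \<in> I \<Longrightarrow> j \<in> I \<Longrightarrow> \<delta>B i (\<delta>B j b) = \<delta>B j (\<delta>B i b)"
    using assms(2) unfolding differential_algebra_def differential_hom_def differential_ring_def
    by auto
  obtain h :: "rat \<Rightarrow> 'a" where h: "is_ring_hom h"
    using assms(1) unfolding ritt_algebra_def by blast
  obtain G where G: "finite G" "generated_algebra \<phi> (derivatives I \<delta>B G) = UNIV"
    using assms(3) unfolding differentially_finitely_generated_def by blast
  \<comment> \<open>Numbering derivations and generators by naturals supplies the linear orders on
    which the ranking rests.\<close>
  obtain \<iota> :: "nat \<Rightarrow> 'i" and m where \<iota>: "I = \<iota> ` {..<m}"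
    using finite_imp_nat_seg_image_inj_on[OF finI] unfolding lessThan_def by blast
  obtain g :: "nat \<Rightarrow> 'b" and n where g: "G = g ` {..<n}"
    using finite_imp_nat_seg_image_inj_on[OF G(1)] unfolding lessThan_def by blast
  text \<open>Extending by the zero derivation makes the operators commute for all indices, as
    folding over a multiset requires.\<close>
  define \<delta> where "\<delta> j = (if j < m then \<delta>B (\<iota> j) else (\<lambda>_. 0))" for j
  define U where "U = {M. set_mset M \<subseteq> {..<m}} \<times> {..<n}"
  define D :: "nat \<Rightarrow> nat multiset \<times> nat \<Rightarrow> nat multiset \<times> nat"
    where "D = (\<lambda>j (M, k). (add_mset j M, k))"
  \<comment> \<open>\<open>(M, k)\<close> stands for the generator \<open>g k\<close> differentiated
    once for each element of \<open>M\<close>, with multiplicity; a multiset suffices because the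
    operators commute.\<close>
  define x where "x = (\<lambda>(M, k). fold_mset \<delta> (g k) M)"
  have \<iota>I: "\<iota> j \<in> I" if "j < m" for j using \<iota> that by auto
  interpret comp_fun_commute \<delta>
  proof
    fix i j show "\<delta> i \<circ> \<delta> j = \<delta> j \<circ> \<delta> i"
      unfolding \<delta>_def fun_eq_iff using commute \<iota>I derivation_0[OF der[OF \<iota>I]] by auto
  qed
  obtain r :: "nat multiset \<times> nat \<Rightarrow> nat" where r_inj: "inj_on r U"
    and r_iff: "\<And>u v. u \<in> U \<Longrightarrow> v \<in> U \<Longrightarrow> r u < r v \<longleftrightarrow> orderly_key u < orderly_key v"
    using orderly_rank_exists[of m n] unfolding U_def by blast
  have D_in: "D j u \<in> U" if "j \<in> {..<m}" "u \<in> U" for j u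
    using that unfolding D_def U_def by (auto split: prod.splits)
  have x_D: "x (D j u) = \<delta> j (x u)" for j u
    unfolding D_def x_def by (simp split: prod.splits)
  have "derivatives I \<delta>B G \<subseteq> x ` U"
  proof
    fix b assume "b \<in> derivatives I \<delta>B G"
    then show "b \<in> x ` U"
    proof induction
      case (base b)
      then obtain k where "k < n" "b = g k" using g by auto
      then have "b = x ({#}, k)" "({#}, k) \<in> U" unfolding x_def U_def by auto
      then show ?case by blast
    next
      case (step b i)
      then obtain u where u: "u \<in> U" "b = x u" by auto
      obtain j where j: "j < m" "i = \<iota> j" using step.hyps(2) \<iota> by auto
      have "\<delta>B i b = x (D j u)" using j u by (simp add: x_D \<delta>_def)
      then show ?case using D_in[of j u] j(1) u(1) by auto
    qed
  qed
  then have gen: "generated_algebra \<phi> (x ` U) = UNIV"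
    using generated_algebra_mono[of _ "x ` U" \<phi>] G(2) by blast
  interpret ranked_differential_algebra \<phi> "{..<m}" \<delta> U D x r
  proof
    show "\<delta> j (\<phi> a) \<in> range \<phi>" if "j \<in> {..<m}" for j a
      using that comm[OF \<iota>I, symmetric] by (auto simp: \<delta>_def)
    \<comment> \<open>Adding \<open>j\<close> to a multiset raises its size by one; adding it to two
      multisets preserves their comparison, which gives the next claim.\<close>
    show "r u < r (D j u)" if "j \<in> {..<m}" "u \<in> U" for j u
      using that D_in[OF that] by (auto simp: r_iff orderly_key_def D_def split: prod.splits)
    show "r (D j u) < r (D j v)" if "j \<in> {..<m}" "u \<in> U" "v \<in> U" "r u < r v" for j u v
      using that D_in[of j u] D_in[of j v]
      by (auto simp: r_iff orderly_key_def D_def split: prod.splits)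
    show "\<exists>T\<subseteq>S. finite T \<and> S \<subseteq> derivatives {..<m} D T" if "S \<subseteq> U" for S
      using dickson_indexed[of "{..<m}" S n] that unfolding U_def D_def by simp
    show "of_nat (Suc n) \<noteq> (0::'b)" for n
      by (rule ritt_algebra_char_0[OF h hom])
  qed (use hom der \<iota>I D_in x_D r_inj gen in \<open>auto simp: \<delta>_def\<close>)
  show ?thesis by (rule localization_is_polynomial_ring)
qed

end
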